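(* Let $n\ge 2$ and let $G$ be the infinite $n$-regular tree. Then for every $p = b/n$ with $b \in\{0,1,\ldots,n\}$ there exists a locally $p$-biased function $f:G\to\{-1,1\}$.
   Context: For a graph $G$ in which every vertex has finite positive degree, a function $f$ from the vertices of $G$ to $\{-1,1\}$ is called locally $p$-biased if for every vertex $x$, $|\{y\sim x : f(y)=1\}|/\deg(x) = p$. *)

theory Defs
  imports Complex_Main "HOL-Library.FuncSet" "Graph_Theory.Digraph_Component"
begin

text \<open>
  A simple undirected graph, possibly infinite, is a symmetric loop-free relation on its vertex
  set, that is, a \<^locale>\<open>pair_bidirected_digraph\<close>. An edge \<open>{u, v}\<close> is then the pair of arcs
  \<open>(u, v)\<close>, \<open>(v, u)\<close>, and the degree of a vertex is its \<^const>\<open>out_degree\<close>.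

  The predicate \<^const>\<open>tree\<close> of the library cannot be used here: it counts the closed walk
  \<open>u, v, u\<close> along a single edge as a (directed) cycle. A cycle of the undirected graph is a
  directed cycle of length at least 3. The null graph is not connected.
\<close>

definition undirected_tree :: "'a pair_pre_digraph \<Rightarrow> bool" where
  "undirected_tree G \<longleftrightarrow>
     pair_bidirected_digraph G \<and>
     Digraph_Component.connected (with_proj G) \<and>
     \<not> (\<exists>c. pre_digraph.cycle (with_proj G) c \<and> length c \<ge> 3)"

text \<open>
  As \<^const>\<open>out_degree\<close> is a cardinality, which is 0 for an infinite set, this expresses
  regularity only for \<open>n > 0\<close>.
\<close>

definition regular_graph :: "nat \<Rightarrow> 'a pair_pre_digraph \<Rightarrow> bool" where
  "regular_graph n G \<longleftrightarrow> (\<forall>v \<in> pverts G. out_degree (with_proj G) v = n)"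

text \<open>
  Meaningful for graphs in which every vertex has finite positive degree. Only the values of
  \<open>f\<close> on the vertices of \<open>G\<close> matter.
\<close>

definition locally_biased :: "'a pair_pre_digraph \<Rightarrow> real \<Rightarrow> ('a \<Rightarrow> int) \<Rightarrow> bool" where
  "locally_biased G p f \<longleftrightarrow>
     f \<in> pverts G \<rightarrow> {-1, 1} \<and>
     (\<forall>x \<in> pverts G.
        real (card {y. (x, y) \<in> parcs G \<and> f y = 1}) / real (out_degree (with_proj G) x) = p)"

end

theory Submission
  imports Defs
begin

text \<open>
  Fix a root \<open>r\<close> of the tree. Every other vertex \<open>v\<close> has exactly one neighbour that is no farther
  from \<open>r\<close> than \<open>v\<close> itself, its parent: two such neighbours would be joined by a path through \<open>r\<close>
  that avoids \<open>v\<close>, and closing it up at \<open>v\<close> would give a cycle. All other neighbours are children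
  of \<open>v\<close>, so every edge joins a parent to its child (\<open>tree_rooting\<close>).

  If \<open>0 < b < n\<close>, the set \<open>S\<close> of vertices with value \<open>1\<close> can therefore be built downwards from the
  root (\<open>exists_set_with_neighbour_count\<close>). Once \<open>v\<close> and its parent have been decided, the
  condition at \<open>v\<close> asks for exactly \<open>b\<close> of the \<open>n - 1\<close> children in \<open>S\<close>, or \<open>b - 1\<close> of them if the
  parent is in \<open>S\<close>; both numbers lie between \<open>0\<close> and \<open>n - 1\<close>. The choices never conflict, since a
  vertex is the child of only one other. The extreme cases \<open>b = 0\<close> and \<open>b = n\<close> are constant
  functions.
\<close>

section \<open>Parents in a rooted tree\<close>

definition delete_vertex :: "'a pair_pre_digraph \<Rightarrow> 'a \<Rightarrow> 'a pair_pre_digraph" where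
  "delete_vertex G y =
     \<lparr>pverts = pverts G - {y}, parcs = {(u, v). (u, v) \<in> parcs G \<and> u \<noteq> y \<and> v \<noteq> y}\<rparr>"

definition hops :: "'a pair_pre_digraph \<Rightarrow> 'a \<Rightarrow> 'a \<Rightarrow> nat" where
  "hops G r v = (LEAST k. (r, v) \<in> parcs G ^^ k)"

lemma hops_0_imp_eq:
  assumes "(r, v) \<in> (parcs G)\<^sup>*" and "hops G r v = 0"
  shows "v = r"
proof -
  obtain k where "(r, v) \<in> parcs G ^^ k"
    using assms(1) rtrancl_imp_relpow by metis
  then have "(r, v) \<in> parcs G ^^ hops G r v"
    unfolding hops_def by (rule LeastI)
  then show ?thesis using assms(2) by simp
qed

lemma hops_SucE:
  assumes "(r, v) \<in> (parcs G)\<^sup>*" and "hops G r v = Suc k"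
  obtains u where "(u, v) \<in> parcs G" "(r, u) \<in> (parcs G)\<^sup>*" "hops G r u \<le> k"
proof -
  obtain j where "(r, v) \<in> parcs G ^^ j"
    using assms(1) rtrancl_imp_relpow by metis
  then have "(r, v) \<in> parcs G ^^ hops G r v"
    unfolding hops_def by (rule LeastI)
  then obtain u where u: "(r, u) \<in> parcs G ^^ k" "(u, v) \<in> parcs G"
    using assms(2) by auto
  moreover have "hops G r u \<le> k"
    unfolding hops_def using u(1) by (rule Least_le)
  ultimately show ?thesis
    using that relpow_imp_rtrancl by metis
qed

context pair_bidirected_digraph
begin

lemma pair_wf_digraph_delete_vertex: "pair_wf_digraph (delete_vertex G y)"
  by unfold_locales (auto simp: delete_vertex_def dest: wellformed')

lemma pair_sym_digraph_delete_vertex: "pair_sym_digraph (delete_vertex G y)"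
proof -
  interpret D: pair_wf_digraph "delete_vertex G y"
    by (rule pair_wf_digraph_delete_vertex)
  show ?thesis
    by unfold_locales
      (auto simp: delete_vertex_def symmetric_def intro!: symI arcs_symmetric)
qed

text \<open>
  Closing up at \<open>y\<close> a path between two neighbours of \<open>y\<close> that avoids \<open>y\<close> gives a cycle. The
  neighbours being distinct, the path has an arc, hence the cycle has length at least 3.
\<close>

lemma cycle_through_deleted_vertex:
  assumes "(y, x1) \<in> parcs G" and "(y, x2) \<in> parcs G" and "x1 \<noteq> x2"
    and reach: "x1 \<rightarrow>\<^sup>*\<^bsub>with_proj (delete_vertex G y)\<^esub> x2"
  shows "\<exists>c. cycle c \<and> length c \<ge> 3"
proof -
  interpret D: pair_wf_digraph "delete_vertex G y"
    by (rule pair_wf_digraph_delete_vertex)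
  obtain p where p: "D.apath x1 p x2"
    using reach D.reachable_apath by blast
  have w: "D.awalk x1 p x2" and dist: "distinct (pawalk_verts x1 p)"
    using p by (auto simp: D.apath_def)
  have arcs: "set p \<subseteq> parcs G" and cas: "pcas x1 p x2"
    using w unfolding D.awalk_def by (auto simp: delete_vertex_def)
  have "set (pawalk_verts x1 p) \<subseteq> pverts (delete_vertex G y)"
    using w by (rule D.awalkE)
  then have avoid: "y \<notin> set (pawalk_verts x1 p)"
    by (auto simp: delete_vertex_def)
  have wG: "awalk x1 p x2"
    using arcs cas assms(1) by (auto simp: awalk_def dest: wellformed')
  have last_arc: "(x2, y) \<in> parcs G"
    using assms(2) by (rule arcs_symmetric)
  have "p \<noteq> []" using cas assms(3) by auto
  let ?c = "(y, x1) # p @ [(x2, y)]"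
  have last: "awlast x1 p = x2" using wG by auto
  have "awalk y ?c y"
    using wG last_arc assms(1) last by (auto simp: awalk_simps dest: wellformed')
  moreover have "pawalk_verts x1 (p @ [(x2, y)]) = pawalk_verts x1 p @ [y]"
    using cas by (induction p arbitrary: x1) auto
  then have "distinct (tl (pawalk_verts y ?c))"
    using dist avoid by simp
  moreover have "length ?c \<ge> 3" using \<open>p \<noteq> []\<close> by (cases p) auto
  ultimately show ?thesis unfolding cycle_def by blast
qed

text \<open>All vertices before \<open>x\<close> on a shortest path from the root are closer to the root than \<open>x\<close>.\<close>

lemma reachable_avoiding_farther_vertex:
  assumes "(r, x) \<in> (parcs G)\<^sup>*" and "r \<in> pverts G" and "hops G r x \<le> hops G r y" and "x \<noteq> y"
  shows "r \<rightarrow>\<^sup>*\<^bsub>with_proj (delete_vertex G y)\<^esub> x"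
  using assms
proof (induction "hops G r x" arbitrary: x rule: less_induct)
  case less
  interpret D: pair_wf_digraph "delete_vertex G y"
    by (rule pair_wf_digraph_delete_vertex)
  show ?case
  proof (cases "hops G r x")
    case 0
    then have "x = r" using less.prems(1) by (rule hops_0_imp_eq[rotated])
    moreover have "x \<in> pverts (delete_vertex G y)"
      using less.prems \<open>x = r\<close> by (simp add: delete_vertex_def)
    ultimately show ?thesis by simp
  next
    case (Suc k)
    then obtain u where u: "(u, x) \<in> parcs G" "(r, u) \<in> (parcs G)\<^sup>*" "hops G r u \<le> k"
      using less.prems(1) hops_SucE by metis
    then have "u \<noteq> y" using Suc less.prems(3) by auto
    then have "r \<rightarrow>\<^sup>*\<^bsub>with_proj (delete_vertex G y)\<^esub> u"
      using less.hyps[of u] u Suc less.prems by auto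
    moreover have "(u, x) \<in> parcs (delete_vertex G y)"
      using u \<open>u \<noteq> y\<close> less.prems(4) by (auto simp: delete_vertex_def)
    ultimately show ?thesis
      using D.reachable_adj_trans by auto
  qed
qed

lemma unique_neighbour_not_farther:
  assumes acyclic: "\<not> (\<exists>c. cycle c \<and> length c \<ge> 3)"
    and "r \<in> pverts G" and conn: "\<And>v. v \<in> pverts G \<Longrightarrow> (r, v) \<in> (parcs G)\<^sup>*"
    and arcs: "(y, x1) \<in> parcs G" "(y, x2) \<in> parcs G"
    and "hops G r x1 \<le> hops G r y" and "hops G r x2 \<le> hops G r y"
  shows "x1 = x2"
proof (rule ccontr)
  assume "x1 \<noteq> x2"
  interpret D: pair_sym_digraph "delete_vertex G y"
    by (rule pair_sym_digraph_delete_vertex)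
  have "x1 \<noteq> y" "x2 \<noteq> y" using arcs by (auto dest: no_loops)
  then have "r \<rightarrow>\<^sup>*\<^bsub>with_proj (delete_vertex G y)\<^esub> x1" "r \<rightarrow>\<^sup>*\<^bsub>with_proj (delete_vertex G y)\<^esub> x2"
    using assms by (auto intro!: reachable_avoiding_farther_vertex dest: wellformed')
  then have "x1 \<rightarrow>\<^sup>*\<^bsub>with_proj (delete_vertex G y)\<^esub> x2"
    using symmetric_reachable[OF D.sym_arcs] D.reachable_trans by blast
  then show False
    using cycle_through_deleted_vertex arcs \<open>x1 \<noteq> x2\<close> acyclic by blast
qed

end

text \<open>
  The function \<open>d\<close> only serves as a measure for recursion along \<open>par\<close>. The value of \<open>par\<close> at the
  root is arbitrary and may even be a neighbour of the root.
\<close>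

lemma tree_rooting:
  assumes "undirected_tree G" and r: "r \<in> pverts G"
  obtains par :: "'a \<Rightarrow> 'a" and d :: "'a \<Rightarrow> nat" where
    "\<And>v. v \<in> pverts G \<Longrightarrow> v \<noteq> r \<Longrightarrow> (v, par v) \<in> parcs G \<and> d (par v) < d v"
    "\<And>v w. (v, w) \<in> parcs G \<Longrightarrow> v = r \<or> w \<noteq> par v \<Longrightarrow> w \<noteq> r \<and> par w = v"
proof -
  interpret pair_bidirected_digraph G
    using assms(1) by (simp add: undirected_tree_def)
  have acyclic: "\<not> (\<exists>c. cycle c \<and> length c \<ge> 3)"
    using assms(1) by (simp add: undirected_tree_def)
  have "strongly_connected (with_proj G)"
    using assms(1) symmetric_connected_imp_strongly_connected sym_arcs
    by (simp add: undirected_tree_def)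
  then have conn: "(r, v) \<in> (parcs G)\<^sup>*" if "v \<in> pverts G" for v
    using that r reachable_rtranclI[of "with_proj G" r v] by (simp add: strongly_connected_def)
  define d where "d = hops G r"
  have ex_par: "\<exists>u. (v, u) \<in> parcs G \<and> d u < d v" if v: "v \<in> pverts G" "v \<noteq> r" for v
  proof (cases "d v")
    case 0
    then show ?thesis using hops_0_imp_eq conn v unfolding d_def by metis
  next
    case (Suc k)
    then obtain u where "(u, v) \<in> parcs G" "d u \<le> k"
      using hops_SucE[OF conn[OF v(1)]] unfolding d_def by metis
    then have "(v, u) \<in> parcs G \<and> d u < d v" using Suc arcs_symmetric by simp
    then show ?thesis by blast
  qed
  define par where "par v = (SOME u. (v, u) \<in> parcs G \<and> d u < d v)" for v
  have par: "(v, par v) \<in> parcs G \<and> d (par v) < d v" if "v \<in> pverts G" "v \<noteq> r" for v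
    unfolding par_def using ex_par[OF that] by (rule someI_ex)
  have "d r = 0" unfolding d_def hops_def by (rule Least_eq_0) simp
  have unique: "x1 = x2" if "(y, x1) \<in> parcs G" "(y, x2) \<in> parcs G" "d x1 \<le> d y" "d x2 \<le> d y"
    for y x1 x2
    using unique_neighbour_not_farther[OF acyclic r conn] that unfolding d_def by blast
  have child: "w \<noteq> r \<and> par w = v" if vw: "(v, w) \<in> parcs G" "v = r \<or> w \<noteq> par v" for v w
  proof -
    have V: "v \<in> pverts G" "w \<in> pverts G" using vw(1) by (auto dest: wellformed')
    have "v \<noteq> w" using vw(1) by (auto dest: no_loops)
    have "d v < d w"
    proof (cases "v = r")
      case True
      then show ?thesis
        using \<open>d r = 0\<close> \<open>v \<noteq> w\<close> par[OF V(2)] by auto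
    next
      case False
      then show ?thesis
        using unique[OF vw(1), of "par v"] par[OF V(1)] vw(2) by force
    qed
    then have "w \<noteq> r" using \<open>d r = 0\<close> by auto
    then show ?thesis
      using unique[OF _ arcs_symmetric[OF vw(1)], of "par w"] par[OF V(2)] \<open>d v < d w\<close> by auto
  qed
  show ?thesis using that par child by blast
qed

section \<open>Prescribing the number of marked neighbours\<close>

text \<open>
  The bounds \<open>0 < b < n\<close> ensure that whatever the parent of a vertex is, enough children are left
  to be marked or not, so that the choices made closer to the root never need revision.
\<close>

lemma exists_set_with_neighbour_count:
  assumes "undirected_tree G" and r: "r \<in> pverts G" and "0 < b" and "b < n"
    and deg: "\<And>v. v \<in> pverts G \<Longrightarrow> card (parcs G `` {v}) = n"
  shows "\<exists>S. \<forall>v \<in> pverts G. card (parcs G `` {v} \<inter> S) = b"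
proof -
  interpret pair_bidirected_digraph G
    using assms(1) by (simp add: undirected_tree_def)
  obtain par d where
    par: "\<And>v. v \<in> pverts G \<Longrightarrow> v \<noteq> r \<Longrightarrow> (v, par v) \<in> parcs G \<and> d (par v) < (d v :: nat)"
    and child: "\<And>v w. (v, w) \<in> parcs G \<Longrightarrow> v = r \<or> w \<noteq> par v \<Longrightarrow> w \<noteq> r \<and> par w = v"
    using tree_rooting[OF assms(1) r] by blast
  define children where "children v = {w. (v, w) \<in> parcs G \<and> (v = r \<or> w \<noteq> par v)}" for v
  define T where "T v k = (SOME A. A \<subseteq> children v \<and> card A = k)" for v k
  have T: "T v k \<subseteq> children v \<and> card (T v k) = k" if "k \<le> card (children v)" for v k
  proof -
    have "\<exists>A. A \<subseteq> children v \<and> card A = k"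
      using obtain_subset_with_card_n[OF that] by metis
    then show ?thesis unfolding T_def by (rule someI_ex)
  qed
  \<comment> \<open>Membership of \<open>v\<close> is decided by its parent, which looks at its own parent; the root is left
    unmarked.\<close>
  define F where "F f v \<longleftrightarrow> v \<in> pverts G \<and> v \<noteq> r \<and>
      v \<in> T (par v) (b - of_bool (par v \<noteq> r \<and> f (par (par v))))" for f v
  define f where "f = wfrec (measure d) F"
  have f_rec: "f v \<longleftrightarrow> F f v" for v
  proof -
    have "f v \<longleftrightarrow> F (cut f (measure d) v) v"
      unfolding f_def by (subst wfrec) auto
    also have "\<dots> \<longleftrightarrow> F f v"
    proof (cases "v \<in> pverts G \<and> v \<noteq> r \<and> par v \<noteq> r")
      case True
      then have "d (par (par v)) < d v"
        using par[of v] par[of "par v"] by (auto dest: wellformed')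
      then show ?thesis by (simp add: F_def cut_apply)
    qed (auto simp: F_def)
    finally show ?thesis .
  qed
  have "card (parcs G `` {v} \<inter> Collect f) = b" if v: "v \<in> pverts G" for v
  proof -
    have fin: "finite (parcs G `` {v})"
      using deg[OF v] \<open>b < n\<close> by (intro card_ge_0_finite) simp
    define k where "k = b - of_bool (v \<noteq> r \<and> f (par v))"
    have f_child: "f w \<longleftrightarrow> w \<in> T v k" if "w \<in> children v" for w
      using that child[of v w] f_rec[of w]
      by (auto simp: children_def F_def k_def dest: wellformed')
    show ?thesis
    proof (cases "v = r")
      case True
      then have nb: "children v = parcs G `` {v}" by (auto simp: children_def)
      then have "T v k \<subseteq> children v" "card (T v k) = k"
        using T[of k v] deg[OF v] \<open>b < n\<close> by (auto simp: k_def)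
      moreover have "parcs G `` {v} \<inter> Collect f = children v \<inter> T v k"
        using nb f_child by auto
      ultimately show ?thesis using True by (simp add: Int_absorb1 k_def)
    next
      case False
      have nb: "parcs G `` {v} = insert (par v) (children v)" "par v \<notin> children v"
        using par[OF v False] False by (auto simp: children_def)
      moreover have fin': "finite (children v)" using fin nb(1) by simp
      ultimately have "card (children v) = n - 1" using deg[OF v] by simp
      then have Tv: "T v k \<subseteq> children v" "card (T v k) = k"
        using T[of k v] \<open>b < n\<close> by (auto simp: k_def)
      then have "finite (T v k)" "par v \<notin> T v k" using fin' nb(2) finite_subset by auto
      moreover have "parcs G `` {v} \<inter> Collect f = T v k \<union> (if f (par v) then {par v} else {})"
        using nb f_child Tv(1) by auto
      ultimately show ?thesis using False Tv(2) \<open>0 < b\<close> by (cases "f (par v)") (simp_all add: k_def)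
    qed
  qed
  then show ?thesis by blast
qed

lemma out_degree_eq_card_Image: "out_degree (with_proj G) v = card (parcs G `` {v})"
proof -
  have "out_arcs (with_proj G) v = Pair v ` (parcs G `` {v})"
    by (auto simp: out_arcs_def)
  then show ?thesis
    by (simp add: out_degree_def card_image inj_on_def)
qed

theorem mainTheorem18:
  fixes n b :: nat and p :: real and G :: "'a pair_pre_digraph"
  assumes "n \<ge> 2"
    and "undirected_tree G" and "infinite (pverts G)" and "regular_graph n G"
    and "b \<in> {0..n}" and "p = real b / real n"
  shows "\<exists>f :: 'a \<Rightarrow> int. locally_biased G p f"
proof -
  have deg: "card (parcs G `` {v}) = n" if "v \<in> pverts G" for v
    using assms(4) that by (simp add: regular_graph_def out_degree_eq_card_Image)
  obtain r where r: "r \<in> pverts G"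
    using assms(3) infinite_imp_nonempty by blast
  obtain S where S: "\<And>v. v \<in> pverts G \<Longrightarrow> card (parcs G `` {v} \<inter> S) = b"
  proof -
    consider "b = 0" | "b = n" | "0 < b" "b < n" using assms(5) by fastforce
    then show ?thesis
    proof cases
      case 1
      then show ?thesis using that[of "{}"] by simp
    next
      case 2
      then show ?thesis using that[of UNIV] deg by simp
    next
      case 3
      then show ?thesis
        using exists_set_with_neighbour_count[OF assms(2) r _ _ deg] that by blast
    qed
  qed
  define f :: "'a \<Rightarrow> int" where "f v = (if v \<in> S then 1 else -1)" for v
  have "{w. (v, w) \<in> parcs G \<and> f w = 1} = parcs G `` {v} \<inter> S" for v
    by (auto simp: f_def)
  then have "locally_biased G p f"
    using S assms(4,6) by (auto simp: locally_biased_def regular_graph_def f_def)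
  then show ?thesis by blast
qed

end
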